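(* Let $\mathcal{M}=(N,\mathcal{I})$ be a matroid on $n$ elements and let $b\in[0,1]$. Then there exists a $\left(b,\frac{1-(1-\frac{b}{n})^n}{b}\right)$-balanced contention resolution scheme for the matroid polytope $P_{\mathcal{I}}$.
   Context: The matroid polytope is $P_{\mathcal{I}}=\{\mathbf{x}\in[0,1]^N:\sum_{i\in S}x_i\le r(S)\ \forall S\subseteq N\}$, $r$ the rank function. $R(\mathbf{x})$ contains each $i$ independently with probability $x_i$; $bP_{\mathcal{I}}=\{b\mathbf{x}:\mathbf{x}\in P_{\mathcal{I}}\}$. A $(b,c)$-balanced contention resolution scheme for $P_{\mathcal{I}}$ is a procedure that for every $\mathbf{x}\in bP_{\mathcal{I}}$ and $A\subseteq N$ returns a random set $\pi_{\mathbf{x}}(A)\subseteq A\cap\{i:x_i>0\}$ with $\pi_{\mathbf{x}}(A)\in\mathcal{I}$ with probability 1, such that $\Pr[i\in\pi_{\mathbf{x}}(R(\mathbf{x}))\mid i\in R(\mathbf{x})]\ge c$ for all $i$ with $x_i>0$. *)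

theory Defs
  imports "HOL-Probability.Probability"
begin

locale matroid =
  fixes N :: "'a set" and indep :: "'a set set"
  assumes finite_ground: "finite N"
    and indep_subset: "indep \<subseteq> Pow N"
    and empty_indep: "{} \<in> indep"
    and indep_down_closed: "\<lbrakk>Y \<in> indep; X \<subseteq> Y\<rbrakk> \<Longrightarrow> X \<in> indep"
    and augmentation:
      "\<lbrakk>X \<in> indep; Y \<in> indep; card X < card Y\<rbrakk> \<Longrightarrow> \<exists>y \<in> Y - X. insert y X \<in> indep"

definition rank_fun :: "'a set set \<Rightarrow> 'a set \<Rightarrow> nat" where
  "rank_fun indep S = Max {card X | X. X \<in> indep \<and> X \<subseteq> S}"

text \<open>
  A vector indexed by \<open>N\<close> is an extensional function, i.e. one that is \<open>undefined\<close> outside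
  \<open>N\<close>; scaling therefore has to be restricted to \<open>N\<close> again.
\<close>

definition matroid_polytope :: "'a set \<Rightarrow> 'a set set \<Rightarrow> ('a \<Rightarrow> real) set" where
  "matroid_polytope N indep =
     {x \<in> N \<rightarrow>\<^sub>E {0..1}. \<forall>S \<subseteq> N. (\<Sum>i\<in>S. x i) \<le> real (rank_fun indep S)}"

definition scaled :: "'a set \<Rightarrow> real \<Rightarrow> ('a \<Rightarrow> real) set \<Rightarrow> ('a \<Rightarrow> real) set" where
  "scaled N b P = (\<lambda>x. \<lambda>i\<in>N. b * x i) ` P"

definition random_set :: "'a set \<Rightarrow> ('a \<Rightarrow> real) \<Rightarrow> 'a set pmf" where
  "random_set N x =
     map_pmf (\<lambda>f. {i \<in> N. f i}) (Pi_pmf N False (\<lambda>i. bernoulli_pmf (x i)))"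

text \<open>The joint distribution of the pair \<open>(R(x), \<pi>\<^sub>x(R(x)))\<close>: the internal randomness of
  the scheme is independent of the sampling of \<open>R(x)\<close>.\<close>

definition sample_and_select ::
    "'a set \<Rightarrow> (('a \<Rightarrow> real) \<Rightarrow> 'a set \<Rightarrow> 'a set pmf) \<Rightarrow> ('a \<Rightarrow> real) \<Rightarrow> ('a set \<times> 'a set) pmf"
  where
  "sample_and_select N \<pi> x =
     bind_pmf (random_set N x) (\<lambda>A. map_pmf (\<lambda>B. (A, B)) (\<pi> x A))"

definition balanced_CR_scheme ::
    "'a set \<Rightarrow> 'a set set \<Rightarrow> real \<Rightarrow> real \<Rightarrow> (('a \<Rightarrow> real) \<Rightarrow> 'a set \<Rightarrow> 'a set pmf) \<Rightarrow> bool"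
  where
  "balanced_CR_scheme N indep b c \<pi> \<longleftrightarrow>
     (\<forall>x \<in> scaled N b (matroid_polytope N indep).
        (\<forall>A \<subseteq> N. set_pmf (\<pi> x A) \<subseteq> Pow (A \<inter> {i \<in> N. x i > 0}) \<and>
                 measure_pmf.prob (\<pi> x A) indep = 1) \<and>
        (\<forall>i \<in> N. x i > 0 \<longrightarrow>
           \<P>((A, B) in sample_and_select N \<pi> x. i \<in> B \<bar> i \<in> A) \<ge> c))"

end

theory Submission
  imports Defs
begin

text \<open>
  By finite minimax, a scheme (a random choice function that picks an independent subset of
  every \<open>A\<close>) with ratio \<open>c\<close> exists as soon as for all weights \<open>w \<ge> 0\<close> some choice function has
  expected weight at least \<open>c \<Sum> w\<^sub>i x\<^sub>i\<close>. The greedy algorithm selects an independent set that has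
  full rank on all upper level sets of \<open>w\<close> at once, so it suffices to bound \<open>E[r(R(x) \<inter> S)]\<close> from
  below for the unweighted rank function \<open>r\<close> and every \<open>S \<subseteq> N\<close>.

  For this bound, reveal the elements in a random order. If \<open>R\<close> is the sample after \<open>k\<close> steps,
  then \<open>v \<le> f(R) + \<Sum> p\<^sub>j (f(R + j) - f(R))\<close>, where \<open>f(A) = r(A \<inter> S)\<close> and \<open>v = p(S)\<close>, so revealing a
  uniformly random element of \<open>N\<close> would close a fraction \<open>b/n\<close> of the gap \<open>v - E f\<close>. An exchange
  argument shows that a random element not yet revealed does at least as well, hence after \<open>n\<close>
  steps the gap is at most \<open>(1 - b/n)\<^sup>n v\<close>.
\<close>

section \<open>The correlation gap\<close>

text \<open>The multilinear extension of \<open>f\<close> at \<open>x\<close>. The ground set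
  \<open>T\<close> stays an argument because it varies below: it is the set of elements revealed so
  far.\<close>

definition multilinear_ext :: "('a \<Rightarrow> real) \<Rightarrow> ('a set \<Rightarrow> real) \<Rightarrow> 'a set \<Rightarrow> real" where
  "multilinear_ext x f T = measure_pmf.expectation (random_set T x) f"

section \<open>Expectations over the random set\<close>

lemma set_pmf_random_set: "set_pmf (random_set T x) \<subseteq> Pow T"
  unfolding random_set_def by auto

lemma finite_set_pmf_random_set: "finite T \<Longrightarrow> finite (set_pmf (random_set T x))"
  by (rule finite_subset[OF set_pmf_random_set]) simp

lemma integrable_random_set:
  fixes f :: "'a set \<Rightarrow> real"
  assumes "finite T"
  shows "integrable (measure_pmf (random_set T x)) f"
  by (intro integrable_measure_pmf_finite finite_set_pmf_random_set assms)

lemma multilinear_ext_const: "multilinear_ext x (\<lambda>A. c) T = c"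
  unfolding multilinear_ext_def by simp

lemma multilinear_ext_diff:
  assumes "finite T"
  shows "multilinear_ext x (\<lambda>A. f A - g A) T = multilinear_ext x f T - multilinear_ext x g T"
  unfolding multilinear_ext_def using integrable_random_set[OF assms]
  by (rule Bochner_Integration.integral_diff) (rule integrable_random_set[OF assms])

lemma multilinear_ext_add:
  assumes "finite T"
  shows "multilinear_ext x (\<lambda>A. f A + g A) T = multilinear_ext x f T + multilinear_ext x g T"
  unfolding multilinear_ext_def using integrable_random_set[OF assms]
  by (rule Bochner_Integration.integral_add) (rule integrable_random_set[OF assms])

lemma multilinear_ext_cmult:
  "multilinear_ext x (\<lambda>A. c * f A) T = c * multilinear_ext x f T"
  unfolding multilinear_ext_def by simp

lemma multilinear_ext_sum:
  assumes "finite T"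
  shows "multilinear_ext x (\<lambda>A. \<Sum>i\<in>I. f i A) T = (\<Sum>i\<in>I. multilinear_ext x (f i) T)"
  unfolding multilinear_ext_def
  by (rule Bochner_Integration.integral_sum) (rule integrable_random_set[OF assms])

lemma multilinear_ext_mono:
  assumes "finite T" "\<And>A. A \<subseteq> T \<Longrightarrow> f A \<le> g A"
  shows "multilinear_ext x f T \<le> multilinear_ext x g T"
  unfolding multilinear_ext_def
proof (rule integral_mono_AE)
  show "AE A in measure_pmf (random_set T x). f A \<le> g A"
    using set_pmf_random_set[of T x] by (intro AE_pmfI assms(2)) blast
qed (rule integrable_random_set[OF assms(1)])+

text \<open>Condition on whether \<open>i\<close> is drawn. Hence revealing \<open>i\<close> raises
  the value by \<open>x i\<close> times the expected marginal of \<open>i\<close>, the quantity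
  called \<open>\<Gamma>\<close> below.\<close>

lemma multilinear_ext_insert:
  assumes "finite T" "i \<notin> T" "0 \<le> x i" "x i \<le> 1"
  shows "multilinear_ext x f (insert i T) =
    x i * multilinear_ext x (\<lambda>A. f (insert i A)) T + (1 - x i) * multilinear_ext x f T"
proof -
  let ?P = "Pi_pmf T False (\<lambda>i. bernoulli_pmf (x i))"
  let ?ins = "\<lambda>b h. {j \<in> insert i T. (h(i := b)) j}"
  have "random_set (insert i T) x =
      bind_pmf (bernoulli_pmf (x i)) (\<lambda>b. map_pmf (?ins b) ?P)"
    unfolding random_set_def Pi_pmf_insert'[OF assms(1,2)]
    by (simp add: map_pmf_def bind_assoc_pmf bind_return_pmf)
  also have "(\<lambda>b. map_pmf (?ins b) ?P) =
      (\<lambda>b. map_pmf (\<lambda>A. if b then insert i A else A) (random_set T x))"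
  proof
    fix b
    have "?ins b h = (if b then insert i {j \<in> T. h j} else {j \<in> T. h j})" for h
      using assms(2) by auto
    then show "map_pmf (?ins b) ?P = map_pmf (\<lambda>A. if b then insert i A else A) (random_set T x)"
      unfolding random_set_def by (simp add: map_pmf_comp)
  qed
  finally have *: "random_set (insert i T) x = bind_pmf (bernoulli_pmf (x i))
      (\<lambda>b. map_pmf (\<lambda>A. if b then insert i A else A) (random_set T x))" .
  have fin: "finite (set_pmf (random_set T x))"
    by (rule finite_set_pmf_random_set[OF assms(1)])
  show ?thesis
    unfolding multilinear_ext_def *
    by (subst pmf_expectation_bind[where A = UNIV])
      (use assms(3,4) fin in \<open>auto simp: UNIV_bool\<close>)
qed

lemma prob_mem_random_set:
  assumes "finite N" "i \<in> N" "0 \<le> x i" "x i \<le> 1"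
  shows "measure_pmf.prob (random_set N x) {A. i \<in> A} = x i"
proof -
  have "map_pmf (\<lambda>A. i \<in> A) (random_set N x) = bernoulli_pmf (x i)"
    using assms Pi_pmf_component[OF assms(1), of i False "\<lambda>i. bernoulli_pmf (x i)"]
    by (simp add: random_set_def map_pmf_comp)
  then have "measure_pmf.prob (map_pmf (\<lambda>A. i \<in> A) (random_set N x)) {True} = x i"
    using assms by (simp add: measure_pmf_single)
  then show ?thesis by (simp add: vimage_def)
qed

section \<open>Averaging over subsets of a fixed size\<close>

lemma sum_subsets_Suc:
  fixes h :: "'a set \<Rightarrow> 'a \<Rightarrow> real"
  assumes "finite N"
  shows "(\<Sum>T | T \<subseteq> N \<and> card T = Suc k. \<Sum>j\<in>T. h T j) =
    (\<Sum>U | U \<subseteq> N \<and> card U = k. \<Sum>j\<in>N - U. h (insert j U) j)"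
proof -
  have fin: "finite T" if "T \<subseteq> N" for T using that assms finite_subset by blast
  \<comment> \<open>Double counting: a set \<open>T\<close> with a marked member \<open>j\<close>
    corresponds to \<open>U = T - {j}\<close> with a marked \<open>j\<close> outside. Here
    \<open>j\<close> acts as the element revealed last in a random order.\<close>
  have "(\<Sum>T | T \<subseteq> N \<and> card T = Suc k. \<Sum>j\<in>T. h T j) =
      (\<Sum>(T, j)\<in>(SIGMA T:{T. T \<subseteq> N \<and> card T = Suc k}. T). h T j)"
    using assms by (intro sum.Sigma) (auto dest: fin)
  also have "\<dots> = (\<Sum>(U, j)\<in>(SIGMA U:{U. U \<subseteq> N \<and> card U = k}. N - U). h (insert j U) j)"
    by (rule sum.reindex_bij_witness[where i = "\<lambda>(U, j). (insert j U, j)"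
          and j = "\<lambda>(T, j). (T - {j}, j)"])
      (auto simp: insert_absorb card_insert_if dest: fin)
  also have "\<dots> = (\<Sum>U | U \<subseteq> N \<and> card U = k. \<Sum>j\<in>N - U. h (insert j U) j)"
    using assms by (intro sum.Sigma[symmetric]) auto
  finally show ?thesis .
qed

lemma sum_off_diagonal_mono:
  fixes p :: "'a \<Rightarrow> real"
  assumes "finite W" and pq: "\<And>i j. i \<in> W \<Longrightarrow> j \<in> W \<Longrightarrow> i \<noteq> j \<Longrightarrow> p i + p j \<le> q i j + q j i"
  shows "(\<Sum>i\<in>W. \<Sum>j\<in>W - {i}. p i) \<le> (\<Sum>i\<in>W. \<Sum>j\<in>W - {i}. q i j)"
proof -
  \<comment> \<open>With \<open>p i\<close> on the diagonal the pairwise inequality also holds for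
    \<open>i = j\<close>. The sums then run over the full square, where swapping the indices shows
    that each side is counted twice.\<close>
  define q' where "q' i j = (if i = j then p i else q i j)" for i j
  have "(\<Sum>i\<in>W. \<Sum>j\<in>W. p i + p j) \<le> (\<Sum>i\<in>W. \<Sum>j\<in>W. q' i j + q' j i)"
    by (intro sum_mono) (use pq in \<open>auto simp: q'_def\<close>)
  moreover have "(\<Sum>i\<in>W. \<Sum>j\<in>W. p j) = (\<Sum>i\<in>W. \<Sum>j\<in>W. p i)"
    by (rule sum.swap)
  moreover have "(\<Sum>i\<in>W. \<Sum>j\<in>W. q' j i) = (\<Sum>i\<in>W. \<Sum>j\<in>W. q' i j)"
    by (rule sum.swap)
  ultimately have "(\<Sum>i\<in>W. \<Sum>j\<in>W. p i) \<le> (\<Sum>i\<in>W. \<Sum>j\<in>W. q' i j)"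
    by (simp only: sum.distrib)
  moreover have "(\<Sum>j\<in>W. p i) = p i + (\<Sum>j\<in>W - {i}. p i)" if "i \<in> W" for i
    by (rule sum.remove[OF assms(1) that])
  moreover have "(\<Sum>j\<in>W. q' i j) = p i + (\<Sum>j\<in>W - {i}. q i j)" if "i \<in> W" for i
  proof -
    have "(\<Sum>j\<in>W - {i}. q' i j) = (\<Sum>j\<in>W - {i}. q i j)"
      by (intro sum.cong) (auto simp: q'_def)
    then show ?thesis using sum.remove[OF assms(1) that, of "q' i"] by (simp add: q'_def)
  qed
  ultimately show ?thesis
    by (simp only: sum.distrib cong: sum.cong)
qed

text \<open>
  With \<open>a\<close>, \<open>d\<close> the expected marginal values of \<open>i\<close>, \<open>j\<close> and \<open>m\<close> their overlap, the difference of the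
  two sides is \<open>x\<^sub>i\<^sup>2 (a - m) + x\<^sub>j\<^sup>2 (d - m) + m (x\<^sub>i - x\<^sub>j)\<^sup>2\<close>, and submodularity and monotonicity
  give \<open>0 \<le> m \<le> min a d\<close>.
\<close>
lemma exchange_marginals:
  fixes f :: "'a set \<Rightarrow> real"
  assumes fin: "finite N" and x: "\<And>i. i \<in> N \<Longrightarrow> 0 \<le> x i \<and> x i \<le> 1"
    and mono: "\<And>A i. A \<subseteq> N \<Longrightarrow> i \<in> N \<Longrightarrow> f A \<le> f (insert i A)"
    and submod: "\<And>A i j. A \<subseteq> N \<Longrightarrow> i \<in> N \<Longrightarrow> j \<in> N \<Longrightarrow>
      f (insert i (insert j A)) + f A \<le> f (insert i A) + f (insert j A)"
    and \<Gamma>: "\<And>i T. \<Gamma> i T = x i * multilinear_ext x (\<lambda>A. f (insert i A) - f A) T"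
    and U: "U \<subseteq> N" "i \<in> N - U" "j \<in> N - U" "i \<noteq> j"
  shows "\<Gamma> i (insert i U) + \<Gamma> j (insert j U) \<le> \<Gamma> j (insert i U) + \<Gamma> i (insert j U)"
proof -
  have finU: "finite U" using U(1) fin finite_subset by blast
  let ?E = "\<lambda>f. multilinear_ext x f U"
  define a where "a = ?E (\<lambda>A. f (insert i A)) - ?E f"
  define d where "d = ?E (\<lambda>A. f (insert j A)) - ?E f"
  define m where "m = a + d - (?E (\<lambda>A. f (insert i (insert j A))) - ?E f)"
  have sub: "insert i A \<subseteq> N" "insert j A \<subseteq> N" "A \<subseteq> N" if "A \<subseteq> U" for A
    using that U by auto
  have ij: "i \<in> N" "j \<in> N" "i \<notin> U" "j \<notin> U" using U by auto
  have "?E (\<lambda>A. f (insert i (insert j A)) + f A) \<le> ?E (\<lambda>A. f (insert i A) + f (insert j A))"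
    by (intro multilinear_ext_mono finU submod sub ij)
  then have m0: "0 \<le> m"
    unfolding m_def a_def d_def by (simp add: multilinear_ext_add finU)
  have "?E (\<lambda>A. f (insert i A)) \<le> ?E (\<lambda>A. f (insert j (insert i A)))"
    by (intro multilinear_ext_mono finU mono sub ij)
  then have md: "m \<le> d"
    unfolding m_def a_def d_def insert_commute[of i j] by simp
  have "?E (\<lambda>A. f (insert j A)) \<le> ?E (\<lambda>A. f (insert i (insert j A)))"
    by (intro multilinear_ext_mono finU mono sub ij)
  then have ma: "m \<le> a"
    unfolding m_def a_def d_def by simp
  have x': "0 \<le> x i" "x i \<le> 1" "0 \<le> x j" "x j \<le> 1" using x ij by auto
  \<comment> \<open>Condition on the element revealed last: if it was drawn, its own marginal
    vanishes and that of the other element drops by the overlap \<open>m\<close>.\<close>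
  have "\<Gamma> i (insert i U) = x i * ((1 - x i) * a)"
    "\<Gamma> j (insert j U) = x j * ((1 - x j) * d)"
    "\<Gamma> j (insert i U) = x j * (x i * (d - m) + (1 - x i) * d)"
    "\<Gamma> i (insert j U) = x i * (x j * (a - m) + (1 - x j) * a)"
    unfolding \<Gamma> a_def d_def m_def
    using x' ij finU by (simp_all add: multilinear_ext_insert multilinear_ext_diff
        multilinear_ext_const insert_commute[of j i] algebra_simps)
  then have "\<Gamma> j (insert i U) + \<Gamma> i (insert j U) - (\<Gamma> i (insert i U) + \<Gamma> j (insert j U)) =
      (x i)\<^sup>2 * (a - m) + (x j)\<^sup>2 * (d - m) + m * (x i - x j)\<^sup>2"
    by (simp add: algebra_simps power2_eq_square)
  moreover have "0 \<le> \<dots>"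
    using ma md m0 by (intro add_nonneg_nonneg mult_nonneg_nonneg) auto
  ultimately show ?thesis by linarith
qed

text \<open>The exchange inequality, summed over pairs, favours elements outside \<open>T\<close>.
  For \<open>k < card N\<close>, dividing by both factors gives the meaning: over a uniform
  \<open>k\<close>-subset \<open>T\<close>, a random element of \<open>N - T\<close> has on average
  at least the marginal of a random element of \<open>N\<close>.\<close>

lemma unprocessed_marginals_ge:
  fixes \<Gamma> :: "'a \<Rightarrow> 'a set \<Rightarrow> real"
  assumes fin: "finite N" and "k \<le> card N"
    and ex: "\<And>U i j. U \<subseteq> N \<Longrightarrow> i \<in> N - U \<Longrightarrow> j \<in> N - U \<Longrightarrow> i \<noteq> j \<Longrightarrow>
      \<Gamma> i (insert i U) + \<Gamma> j (insert j U) \<le> \<Gamma> j (insert i U) + \<Gamma> i (insert j U)"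
  shows "real (card N - k) * (\<Sum>T | T \<subseteq> N \<and> card T = k. \<Sum>j\<in>N. \<Gamma> j T)
    \<le> real (card N) * (\<Sum>T | T \<subseteq> N \<and> card T = k. \<Sum>j\<in>N - T. \<Gamma> j T)"
proof -
  define n where "n = card N"
  define D where "D = (\<Sum>T | T \<subseteq> N \<and> card T = k. \<Sum>j\<in>N - T. \<Gamma> j T)"
  define V where "V = (\<Sum>T | T \<subseteq> N \<and> card T = k. \<Sum>j\<in>T. \<Gamma> j T)"
  have finT: "finite T" if "T \<subseteq> N" for T using that fin finite_subset by blast
  have VD: "(\<Sum>T | T \<subseteq> N \<and> card T = k. \<Sum>j\<in>N. \<Gamma> j T) = D + V"
    unfolding D_def V_def sum.distrib[symmetric]
    by (intro sum.cong refl sum.subset_diff) (use fin in auto)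
  \<comment> \<open>This is the claim after cancelling \<open>(n - k) * D\<close> on both
    sides.\<close>
  have "real (n - k) * V \<le> real k * D"
  proof (cases k)
    case 0
    then show ?thesis unfolding V_def using finT
      by (auto intro!: mult_nonneg_nonpos sum_nonpos)
  next
    case (Suc l)
    have card: "card (N - insert i U) = n - k" if "U \<subseteq> N" "card U = l" "i \<in> N - U" for U i
      using that Suc finT[of U] by (subst card_Diff_subset) (auto simp: n_def)
    have "real (n - k) * V = (\<Sum>U | U \<subseteq> N \<and> card U = l. \<Sum>i\<in>N - U. real (n - k) * \<Gamma> i (insert i U))"
      unfolding V_def Suc sum_subsets_Suc[OF fin] by (simp add: sum_distrib_left)
    \<comment> \<open>The factor \<open>n - k\<close> becomes a sum over the partners
      \<open>j\<close> of \<open>i\<close>, so that both sides run over ordered pairs of distinct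
      elements outside \<open>U\<close>.\<close>
    also have "\<dots> = (\<Sum>U | U \<subseteq> N \<and> card U = l. \<Sum>i\<in>N - U. \<Sum>j\<in>(N - U) - {i}. \<Gamma> i (insert i U))"
      by (intro sum.cong refl) (use card in \<open>auto simp: Diff_insert[symmetric]\<close>)
    also have "\<dots> \<le> (\<Sum>U | U \<subseteq> N \<and> card U = l. \<Sum>i\<in>N - U. \<Sum>j\<in>(N - U) - {i}. \<Gamma> j (insert i U))"
      by (intro sum_mono sum_off_diagonal_mono) (use fin ex in auto)
    also have "\<dots> = (\<Sum>U | U \<subseteq> N \<and> card U = l. \<Sum>i\<in>N - U. \<Sum>j\<in>N - insert i U. \<Gamma> j (insert i U))"
      by (simp add: Diff_insert[symmetric])
    also have "\<dots> = (\<Sum>T | T \<subseteq> N \<and> card T = k. \<Sum>i\<in>T. \<Sum>j\<in>N - T. \<Gamma> j T)"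
      unfolding Suc by (rule sum_subsets_Suc[OF fin, symmetric])
    also have "\<dots> = real k * D"
      unfolding D_def by (subst sum_distrib_left) (intro sum.cong refl, auto)
    finally show ?thesis .
  qed
  moreover have "real n * D = real (n - k) * D + real k * D"
    using assms(2) unfolding n_def distrib_right[symmetric] of_nat_add[symmetric] by simp
  ultimately show ?thesis
    unfolding VD D_def[symmetric] n_def[symmetric] distrib_left by linarith
qed

text \<open>\<open>Q k\<close> divided by \<open>n choose k\<close> is the expected value after
  \<open>k\<close> steps in random order; by induction its distance below \<open>v\<close> is at
  most \<open>c ^ k * v\<close>. The assumption on \<open>v\<close> says that the marginals at
  \<open>A\<close>, weighted by \<open>p\<close>, cover the shortfall
  \<open>v - f A\<close>.\<close>

lemma correlation_gap:
  fixes f :: "'a set \<Rightarrow> real"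
  assumes fin: "finite N" and b: "0 \<le> b" "b \<le> 1"
    and p: "\<And>i. i \<in> N \<Longrightarrow> 0 \<le> p i \<and> p i \<le> 1"
    and x: "\<And>i. i \<in> N \<Longrightarrow> x i = b * p i"
    and nonneg: "0 \<le> f {}"
    and mono: "\<And>A i. A \<subseteq> N \<Longrightarrow> i \<in> N \<Longrightarrow> f A \<le> f (insert i A)"
    and submod: "\<And>A i j. A \<subseteq> N \<Longrightarrow> i \<in> N \<Longrightarrow> j \<in> N \<Longrightarrow>
      f (insert i (insert j A)) + f A \<le> f (insert i A) + f (insert j A)"
    and v: "\<And>A. A \<subseteq> N \<Longrightarrow> v \<le> f A + (\<Sum>i\<in>N. p i * (f (insert i A) - f A))"
  shows "(1 - (1 - b / real (card N)) ^ card N) * v \<le> multilinear_ext x f N"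
proof -
  define n where "n = card N"
  define F where "F = multilinear_ext x f"
  define \<Gamma> where "\<Gamma> i T = x i * multilinear_ext x (\<lambda>A. f (insert i A) - f A) T" for i T
  define Q where "Q k = (\<Sum>T | T \<subseteq> N \<and> card T = k. F T)" for k
  define c where "c = 1 - b / real n"
  have finT: "finite T" if "T \<subseteq> N" for T using that fin finite_subset by blast
  have xb: "0 \<le> x i \<and> x i \<le> 1" if "i \<in> N" for i
    using x[OF that] p[OF that] b by (auto intro: mult_le_one)
  have sum_\<Gamma>: "b * (v - F T) \<le> (\<Sum>i\<in>N. \<Gamma> i T)" if "T \<subseteq> N" for T
  proof -
    have "v = multilinear_ext x (\<lambda>A. v) T" by (simp add: multilinear_ext_const)
    also have "\<dots> \<le> multilinear_ext x (\<lambda>A. f A + (\<Sum>i\<in>N. p i * (f (insert i A) - f A))) T"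
      using that v by (intro multilinear_ext_mono finT) auto
    also have "\<dots> = F T + (\<Sum>i\<in>N. p i * multilinear_ext x (\<lambda>A. f (insert i A) - f A) T)"
      unfolding F_def using finT[OF that]
      by (simp add: multilinear_ext_add multilinear_ext_sum multilinear_ext_cmult)
    finally have "b * (v - F T) \<le>
        b * (\<Sum>i\<in>N. p i * multilinear_ext x (\<lambda>A. f (insert i A) - f A) T)"
      by (intro mult_left_mono b) simp
    also have "\<dots> = (\<Sum>i\<in>N. \<Gamma> i T)"
      unfolding \<Gamma>_def by (simp add: sum_distrib_left x mult.assoc)
    finally show ?thesis .
  qed
  have "real (n choose k) * (1 - c ^ k) * v \<le> Q k" if "k \<le> n" for k
    using that
  proof (induction k)
    case 0
    have "{T. T \<subseteq> N \<and> card T = 0} = {{}}" using finT by auto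
    moreover have "0 \<le> F {}"
      unfolding F_def multilinear_ext_def random_set_def using nonneg by simp
    ultimately show ?case by (simp add: Q_def)
  next
    case (Suc k)
    let ?S = "{T. T \<subseteq> N \<and> card T = k}"
    have n: "0 < n" "b \<le> real n" using Suc.prems b by auto
    \<comment> \<open>Nonnegativity of \<open>c\<close> allows the induction hypothesis to be
      inserted into \<open>c * Q k\<close>.\<close>
    have c: "0 \<le> c" using n unfolding c_def by (simp add: field_simps)
    have cardS: "card ?S = n choose k" unfolding n_def by (rule n_subsets[OF fin])
    have "real (Suc k) * Q (Suc k) = (\<Sum>T | T \<subseteq> N \<and> card T = Suc k. \<Sum>j\<in>T. F T)"
      unfolding Q_def sum_distrib_left by (intro sum.cong refl) auto
    also have "\<dots> = (\<Sum>T\<in>?S. \<Sum>j\<in>N - T. F (insert j T))"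
      by (rule sum_subsets_Suc[OF fin])
    also have "\<dots> = (\<Sum>T\<in>?S. \<Sum>j\<in>N - T. F T + \<Gamma> j T)"
    proof (intro sum.cong refl)
      fix T j assume "T \<in> ?S" "j \<in> N - T"
      then show "F (insert j T) = F T + \<Gamma> j T"
        using xb[of j] finT[of T] unfolding F_def \<Gamma>_def
        by (simp add: multilinear_ext_insert multilinear_ext_diff algebra_simps)
    qed
    also have "\<dots> = real (n - k) * Q k + (\<Sum>T\<in>?S. \<Sum>j\<in>N - T. \<Gamma> j T)"
      unfolding sum.distrib Q_def sum_distrib_left
      by (intro arg_cong2[where f = "(+)"] sum.cong refl)
        (use finT in \<open>auto simp: card_Diff_subset n_def\<close>)
    finally have Q: "real (Suc k) * Q (Suc k) =
        real (n - k) * Q k + (\<Sum>T\<in>?S. \<Sum>j\<in>N - T. \<Gamma> j T)" .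
    have "b * (real (n choose k) * v - Q k) = (\<Sum>T\<in>?S. b * (v - F T))"
      unfolding Q_def by (simp add: sum_subtractf cardS sum_distrib_left algebra_simps)
    also have "\<dots> \<le> (\<Sum>T\<in>?S. \<Sum>j\<in>N. \<Gamma> j T)"
      using sum_\<Gamma> by (intro sum_mono) auto
    finally have "real (n - k) * (b * (real (n choose k) * v - Q k)) \<le>
        real (n - k) * (\<Sum>T\<in>?S. \<Sum>j\<in>N. \<Gamma> j T)"
      by (intro mult_left_mono) auto
    also have "\<dots> \<le> real n * (\<Sum>T\<in>?S. \<Sum>j\<in>N - T. \<Gamma> j T)"
      unfolding n_def
      by (rule unprocessed_marginals_ge[OF fin])
        (use Suc.prems in \<open>auto simp: n_def intro!: exchange_marginals[OF fin xb mono submod \<Gamma>_def]\<close>)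
    finally have "real (n - k) * (b * (real (n choose k) * v - Q k)) / real n \<le>
        (\<Sum>T\<in>?S. \<Sum>j\<in>N - T. \<Gamma> j T)"
      using n(1) by (intro mult_imp_div_pos_le)
        (simp_all only: of_nat_0_less_iff mult.commute[of _ "real n"])
    \<comment> \<open>One step moves the average a fraction \<open>1 - c = b / n\<close> of the way
      towards \<open>v\<close>.\<close>
    then have "real (n - k) * (c * Q k + (1 - c) * (real (n choose k) * v)) \<le>
        real (Suc k) * Q (Suc k)"
      unfolding Q c_def by (simp add: algebra_simps diff_divide_distrib)
    moreover have "real (n - k) * (c * (real (n choose k) * (1 - c ^ k) * v) +
        (1 - c) * (real (n choose k) * v)) \<le>
        real (n - k) * (c * Q k + (1 - c) * (real (n choose k) * v))"
      using Suc c by (intro mult_left_mono add_right_mono) auto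
    \<comment> \<open>This passes from the number of \<open>k\<close>-subsets to that of
      \<open>Suc k\<close>-subsets; the rest is
      \<open>c * (1 - c ^ k) + (1 - c) = 1 - c ^ Suc k\<close>.\<close>
    moreover have "real (n - k) * real (n choose k) = real (Suc k) * real (n choose Suc k)"
      using binomial_absorb_comp[of n k] binomial_absorption[of k n]
      by (metis of_nat_mult)
    then have "real (n - k) * (c * (real (n choose k) * (1 - c ^ k) * v) +
        (1 - c) * (real (n choose k) * v)) =
        real (Suc k) * (real (n choose Suc k) * (1 - c ^ Suc k) * v)"
      by (simp add: algebra_simps)
    ultimately have "real (Suc k) * (real (n choose Suc k) * (1 - c ^ Suc k) * v) \<le>
        real (Suc k) * Q (Suc k)" by linarith
    then show ?case
      by (simp only: mult_le_cancel_left_pos of_nat_0_less_iff zero_less_Suc)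
  qed
  from this[of n] have "(1 - c ^ n) * v \<le> Q n" by simp
  moreover have "{T. T \<subseteq> N \<and> card T = n} = {N}"
    unfolding n_def using fin card_subset_eq by auto
  ultimately show ?thesis
    unfolding Q_def F_def c_def n_def by simp
qed

section \<open>A finite minimax theorem\<close>

text \<open>
  A mixture minimising the squared shortfall \<open>\<Phi>\<close> exists by compactness of the simplex. If the
  shortfall \<open>w\<close> were nonzero, moving a little towards a best response to the weights \<open>w\<close> would
  decrease \<open>\<Phi>\<close>.
\<close>
lemma finite_minimax:
  fixes M :: "'s \<Rightarrow> 'i \<Rightarrow> real" and t :: "'i \<Rightarrow> real"
  assumes fin: "finite S" "finite I"
    and dual: "\<And>w. (\<And>i. i \<in> I \<Longrightarrow> 0 \<le> w i) \<Longrightarrow>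
      \<exists>s\<in>S. (\<Sum>i\<in>I. w i * t i) \<le> (\<Sum>i\<in>I. w i * M s i)"
  obtains q where "set_pmf q \<subseteq> S" "\<And>i. i \<in> I \<Longrightarrow> t i \<le> measure_pmf.expectation q (\<lambda>s. M s i)"
proof -
  \<comment> \<open>Mixtures are functions on the whole type, forced to 0 outside \<open>S\<close>,
    so that Tychonoff yields compactness in the product topology even for an infinite type.\<close>
  define \<Delta> where "\<Delta> = {l. (\<forall>s. l s \<in> (if s \<in> S then {0..1} else {0})) \<and> (\<Sum>s\<in>S. l s) = (1::real)}"
  define m where "m l i = (\<Sum>s\<in>S. l s * M s i)" for l i
  define \<Phi> where "\<Phi> l = (\<Sum>i\<in>I. (max 0 (t i - m l i))\<^sup>2)" for l
  obtain s0 where s0: "s0 \<in> S" using dual[of "\<lambda>_. 0"] by auto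
  have "compact (PiE UNIV (\<lambda>s. if s \<in> S then {0..1::real} else {0}))"
    unfolding compactin_euclidean_iff[symmetric] euclidean_product_topology[symmetric] compactin_PiE
    by auto
  moreover have "closed {l::'s \<Rightarrow> real. (\<Sum>s\<in>S. l s) = 1}"
    by (intro closed_Collect_eq continuous_intros continuous_on_product_coordinates)
  moreover have "\<Delta> = PiE UNIV (\<lambda>s. if s \<in> S then {0..1} else {0}) \<inter> {l. (\<Sum>s\<in>S. l s) = 1}"
    unfolding \<Delta>_def PiE_UNIV_domain Pi_def by simp blast
  ultimately have "compact \<Delta>" using compact_Int_closed by metis
  moreover have pure: "(\<lambda>s. if s = s1 then 1 else 0) \<in> \<Delta>" if "s1 \<in> S" for s1
    using that fin by (auto simp: \<Delta>_def)
  then have "\<Delta> \<noteq> {}" using s0 by blast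
  moreover have "continuous_on \<Delta> \<Phi>"
    unfolding \<Phi>_def m_def
    by (intro continuous_intros continuous_on_subset[OF continuous_on_product_coordinates]) auto
  ultimately obtain l where l: "l \<in> \<Delta>" and min: "\<And>l'. l' \<in> \<Delta> \<Longrightarrow> \<Phi> l \<le> \<Phi> l'"
    using continuous_attains_inf by metis
  define w where "w i = max 0 (t i - m l i)" for i
  obtain s1 where s1: "s1 \<in> S" "(\<Sum>i\<in>I. w i * t i) \<le> (\<Sum>i\<in>I. w i * M s1 i)"
    using dual[of w] by (auto simp: w_def)
  define d where "d i = M s1 i - m l i" for i
  define W where "W = (\<Sum>i\<in>I. (w i)\<^sup>2)"
  define B where "B = (\<Sum>i\<in>I. (d i)\<^sup>2)"
  \<comment> \<open>Where the target is met the weight is 0, so the truncation may be dropped in one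
    of the two factors.\<close>
  have "W = (\<Sum>i\<in>I. w i * (t i - m l i))"
    unfolding W_def by (intro sum.cong) (auto simp: w_def max_def power2_eq_square)
  also have "\<dots> \<le> (\<Sum>i\<in>I. w i * d i)"
    unfolding d_def right_diff_distrib sum_subtractf using s1(2) by simp
  finally have Wd: "W \<le> (\<Sum>i\<in>I. w i * d i)" .
  have step: "W \<le> W - 2 * e * W + e\<^sup>2 * B" if e: "0 \<le> e" "e \<le> 1" for e
  proof -
    define l' where "l' s = (1 - e) * l s + e * (if s = s1 then 1 else 0)" for s
    have "l' \<in> \<Delta>"
    proof -
      have "l' s \<in> (if s \<in> S then {0..1} else {0})" for s
      proof (cases "s \<in> S")
        case True
        then have "0 \<le> l s" "l s \<le> 1" using l unfolding \<Delta>_def by (auto dest: spec[of _ s])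
        then show ?thesis using True e
            convex_bound_le[of "l s" 1 "if s = s1 then 1 else 0" "1 - e" e]
          by (auto simp: l'_def)
      next
        case False
        then show ?thesis using l s1 unfolding \<Delta>_def l'_def by (auto dest: spec[of _ s])
      qed
      moreover have "(\<Sum>s\<in>S. l' s) = 1"
        using l pure[OF s1(1)] unfolding l'_def \<Delta>_def by (simp add: sum.distrib sum_distrib_left[symmetric])
      ultimately show ?thesis unfolding \<Delta>_def by blast
    qed
    then have "W \<le> \<Phi> l'" using min unfolding W_def w_def \<Phi>_def by blast
    also have "\<dots> \<le> (\<Sum>i\<in>I. (w i - e * d i)\<^sup>2)"
      unfolding \<Phi>_def
    proof (intro sum_mono)
      fix i
      have "m l' i = (\<Sum>s\<in>S. (1 - e) * (l s * M s i)) + (\<Sum>s\<in>S. if s = s1 then e * M s i else 0)"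
        unfolding m_def l'_def sum.distrib[symmetric]
        by (intro sum.cong) (auto simp: algebra_simps)
      also have "\<dots> = m l i + e * d i"
        unfolding m_def d_def sum_distrib_left[symmetric] using fin s1 by (simp add: algebra_simps)
      \<comment> \<open>Here
        \<open>t i - m l' i = (t i - m l i) - e * d i \<le> w i - e * d i\<close>, and truncation at
        0 preserves this bound up to absolute values.\<close>
      finally have "\<bar>max 0 (t i - m l' i)\<bar> \<le> \<bar>w i - e * d i\<bar>"
        unfolding w_def by (auto simp: max_def)
      then show "(max 0 (t i - m l' i))\<^sup>2 \<le> (w i - e * d i)\<^sup>2"
        by (simp only: abs_le_square_iff)
    qed
    also have "\<dots> = W - 2 * e * (\<Sum>i\<in>I. w i * d i) + e\<^sup>2 * B"
      unfolding W_def B_def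
      by (simp add: power2_diff sum.distrib sum_subtractf sum_distrib_left power_mult_distrib
          algebra_simps)
    also have "\<dots> \<le> W - 2 * e * W + e\<^sup>2 * B"
      using mult_left_mono[OF Wd, of "2 * e"] e by simp
    finally show ?thesis .
  qed
  have W0: "0 \<le> W" "0 \<le> B" unfolding W_def B_def by (auto intro: sum_nonneg)
  have "W = 0"
  proof (rule ccontr)
    assume "W \<noteq> 0"
    then have W: "0 < W" using W0 by simp
    \<comment> \<open>The descent inequality gives \<open>2 * W \<le> e * B\<close>; this
      \<open>e\<close> keeps \<open>e * B\<close> at most \<open>W\<close>. Adding \<open>W\<close>
      to the denominator ensures \<open>e \<le> 1\<close> and covers \<open>B = 0\<close>.\<close>
    define e where "e = W / (W + B)"
    have e: "0 < e" "e \<le> 1" using W W0 by (auto simp: e_def)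
    have "2 * W \<le> e * B"
      using step[of e] e by (simp add: power2_eq_square field_simps)
    also have "\<dots> = W * (B / (W + B))" by (simp add: e_def)
    also have "\<dots> \<le> W * 1" using W W0 by (intro mult_left_mono) auto
    finally show False using W by simp
  qed
  then have "t i \<le> m l i" if "i \<in> I" for i
    using that fin unfolding W_def w_def by (auto simp: sum_nonneg_eq_0_iff max_def split: if_splits)
  moreover
  have l0: "0 \<le> l s" "s \<notin> S \<Longrightarrow> l s = 0" for s
    using l unfolding \<Delta>_def by (auto split: if_splits dest: spec[of _ s])
  have int: "(\<integral>\<^sup>+s. ennreal (l s) \<partial>count_space UNIV) = 1"
  proof -
    have "(\<integral>\<^sup>+s. ennreal (l s) \<partial>count_space UNIV) = (\<Sum>s\<in>S. ennreal (l s))"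
      using fin l0(2) by (intro nn_integral_count_space') auto
    also have "\<dots> = ennreal (\<Sum>s\<in>S. l s)" using l0 by (simp add: sum_ennreal)
    finally show ?thesis using l by (simp add: \<Delta>_def)
  qed
  define q where "q = embed_pmf l"
  have q: "pmf q s = l s" for s
    unfolding q_def using l0 int by (intro pmf_embed_pmf)
  then have sq: "set_pmf q \<subseteq> S" using l0 by (auto simp: set_pmf_eq)
  then have "measure_pmf.expectation q (\<lambda>s. M s i) = m l i" for i
    unfolding m_def by (subst integral_measure_pmf_real[OF fin(1)]) (auto simp: q mult.commute)
  ultimately show ?thesis using that sq by metis
qed

section \<open>Greedy choice in matroids\<close>

text \<open>Abel summation: \<open>w\<close> is a nonnegative combination of indicators of its upper
  level sets. The induction splits off the minimal weight \<open>m\<close>, leaving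
  \<open>w - m\<close> on a strictly smaller set.\<close>

lemma sum_weighted_nonneg:
  fixes w d :: "'a \<Rightarrow> real"
  assumes "finite M" "\<And>i. i \<in> M \<Longrightarrow> 0 \<le> w i"
    and "\<And>t. t \<in> w ` M \<Longrightarrow> 0 \<le> (\<Sum>i | i \<in> M \<and> t \<le> w i. d i)"
  shows "0 \<le> (\<Sum>i\<in>M. w i * d i)"
  using assms
proof (induction M arbitrary: w rule: finite_psubset_induct)
  case (psubset M)
  show ?case
  proof (cases "M = {}")
    case False
    define m where "m = Min (w ` M)"
    define M' where "M' = {i \<in> M. m < w i}"
    have m: "m \<in> w ` M" "\<And>i. i \<in> M \<Longrightarrow> m \<le> w i"
      using False psubset.hyps unfolding m_def by auto
    then have "M' \<subset> M" unfolding M'_def by force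
    then have "0 \<le> (\<Sum>i\<in>M'. (w i - m) * d i)"
    proof (rule psubset.IH)
      fix t assume "t \<in> (\<lambda>i. w i - m) ` M'"
      then have t: "0 < t" "t + m \<in> w ` M" unfolding M'_def by auto
      have "{i. i \<in> M' \<and> t \<le> w i - m} = {i. i \<in> M \<and> t + m \<le> w i}"
        using t unfolding M'_def by auto
      then show "0 \<le> (\<Sum>i | i \<in> M' \<and> t \<le> w i - m. d i)"
        using psubset.prems(2)[OF t(2)] by simp
    qed (auto simp: M'_def)
    also have "\<dots> = (\<Sum>i\<in>M. (w i - m) * d i)"
      using psubset.hyps m(2) by (intro sum.mono_neutral_left) (force simp: M'_def)+
    finally have "0 \<le> (\<Sum>i\<in>M. (w i - m) * d i)" .
    moreover have "{i. i \<in> M \<and> m \<le> w i} = M" using m(2) by auto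
    then have "0 \<le> m * (\<Sum>i\<in>M. d i)"
      using psubset.prems m(1) by (metis (no_types, lifting) imageE mult_nonneg_nonneg)
    ultimately show ?thesis
      by (simp add: left_diff_distrib sum_subtractf sum_distrib_left)
  qed simp
qed

context matroid
begin

section \<open>Independent sets and the rank function\<close>

lemma indep_finite: "X \<in> indep \<Longrightarrow> finite X"
  using indep_subset finite_ground finite_subset by blast

lemma finite_indep_cards: "finite {card X |X. X \<in> indep \<and> X \<subseteq> S}"
proof -
  have "finite indep" using indep_subset finite_ground finite_subset by blast
  then show ?thesis by simp
qed

lemma card_le_rank_fun: "X \<in> indep \<Longrightarrow> X \<subseteq> S \<Longrightarrow> card X \<le> rank_fun indep S"
  unfolding rank_fun_def by (rule Max_ge[OF finite_indep_cards]) auto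

lemma rank_fun_attained: obtains X where "X \<in> indep" "X \<subseteq> S" "card X = rank_fun indep S"
proof -
  have "rank_fun indep S \<in> {card X |X. X \<in> indep \<and> X \<subseteq> S}"
    unfolding rank_fun_def by (rule Max_in[OF finite_indep_cards]) (use empty_indep in auto)
  then show ?thesis using that by auto
qed

lemma rank_fun_mono: "S \<subseteq> T \<Longrightarrow> rank_fun indep S \<le> rank_fun indep T"
  by (metis card_le_rank_fun rank_fun_attained subset_trans)

lemma extend_indep:
  assumes "I \<in> indep" "I \<subseteq> S"
  obtains B where "I \<subseteq> B" "B \<subseteq> S" "B \<in> indep" "card B = rank_fun indep S"
proof -
  have "\<exists>B. I \<subseteq> B \<and> B \<subseteq> S \<and> B \<in> indep \<and> card B = rank_fun indep S"
    using assms
  proof (induction "rank_fun indep S - card I" arbitrary: I)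
    case 0
    then show ?case using card_le_rank_fun by (metis diff_is_0_eq le_antisym order_refl)
  next
    case (Suc k)
    obtain X where X: "X \<in> indep" "X \<subseteq> S" "card X = rank_fun indep S"
      using rank_fun_attained by blast
    have "card I < card X" using Suc.hyps(2) X by simp
    then obtain y where y: "y \<in> X - I" "insert y I \<in> indep"
      using augmentation Suc.prems X by blast
    have "k = rank_fun indep S - card (insert y I)"
      using Suc y indep_finite by (simp add: card_insert_if)
    then show ?case using Suc.hyps(1)[of "insert y I"] y X Suc.prems by blast
  qed
  then show ?thesis using that by blast
qed

text \<open>Extend a maximum independent set \<open>B\<close> of the intersection to one,
  \<open>C\<close>, of the union. The traces of \<open>C\<close> on \<open>S\<close> and
  \<open>T\<close> are independent and together count \<open>C\<close> once and at least
  \<open>B\<close> again.\<close>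

lemma rank_fun_submodular:
  "rank_fun indep (S \<union> T) + rank_fun indep (S \<inter> T) \<le> rank_fun indep S + rank_fun indep T"
proof -
  obtain B where B: "B \<in> indep" "B \<subseteq> S \<inter> T" "card B = rank_fun indep (S \<inter> T)"
    using rank_fun_attained by blast
  then obtain C where C: "B \<subseteq> C" "C \<subseteq> S \<union> T" "C \<in> indep" "card C = rank_fun indep (S \<union> T)"
    using extend_indep[of B "S \<union> T"] by blast
  have fin: "finite C" using C indep_finite by blast
  have "card (C \<inter> S) + card (C \<inter> T) = card ((C \<inter> S) \<union> (C \<inter> T)) + card ((C \<inter> S) \<inter> (C \<inter> T))"
    using fin by (intro card_Un_Int) auto
  moreover have "(C \<inter> S) \<union> (C \<inter> T) = C" using C by auto
  moreover have "card B \<le> card ((C \<inter> S) \<inter> (C \<inter> T))"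
    using fin B C by (intro card_mono) auto
  moreover have "card (C \<inter> S) \<le> rank_fun indep S" "card (C \<inter> T) \<le> rank_fun indep T"
    using C indep_down_closed by (auto intro!: card_le_rank_fun)
  ultimately show ?thesis using B C by simp
qed

text \<open>Provides the assumption on \<open>v\<close> in \<open>correlation_gap\<close>. Elements
  of \<open>S\<close> spanned by \<open>A \<inter> S\<close> are bounded together by a polytope
  constraint; each other element is paid for by its own marginal.\<close>

lemma polytope_sum_le_marginals:
  assumes p: "p \<in> matroid_polytope N indep" and S: "S \<subseteq> N"
  shows "(\<Sum>i\<in>S. p i) \<le> real (rank_fun indep (A \<inter> S)) +
    (\<Sum>i\<in>N. p i * (real (rank_fun indep (insert i A \<inter> S)) - real (rank_fun indep (A \<inter> S))))"
proof -
  define r where "r = rank_fun indep (A \<inter> S)"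
  \<comment> \<open>\<open>C\<close> is the closure of \<open>A \<inter> S\<close> within \<open>S\<close>: it has rank \<open>r\<close>, and all other elements of \<open>S\<close>
    have marginal value at least 1.\<close>
  define C where "C = {j \<in> S. rank_fun indep (insert j (A \<inter> S)) = r}"
  have finS: "finite S" using S finite_ground finite_subset by blast
  have "p \<in> N \<rightarrow>\<^sub>E {0..1}" using p unfolding matroid_polytope_def by blast
  then have p0: "0 \<le> p i" if "i \<in> N" for i using PiE_mem that by force
  have gain: "r \<le> rank_fun indep (insert i A \<inter> S)" for i
    unfolding r_def by (intro rank_fun_mono) auto
  have "rank_fun indep C \<le> r"
  proof -
    obtain B where B: "B \<in> indep" "B \<subseteq> A \<inter> S" "card B = r"
      unfolding r_def using rank_fun_attained by blast
    have "A \<inter> S \<subseteq> C" unfolding C_def r_def by (auto simp: insert_absorb)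
    then obtain B' where B': "B \<subseteq> B'" "B' \<subseteq> C" "B' \<in> indep" "card B' = rank_fun indep C"
      using extend_indep[of B C] B by blast
    \<comment> \<open>A further \<open>j\<close> would make \<open>insert j B\<close> an independent
      set of size \<open>Suc r\<close> inside \<open>insert j (A \<inter> S)\<close>, against
      \<open>j \<in> C\<close>.\<close>
    have "B' \<subseteq> B"
    proof
      fix j assume j: "j \<in> B'"
      show "j \<in> B"
      proof (rule ccontr)
        assume "j \<notin> B"
        then have "card (insert j B) = Suc r" using B indep_finite by simp
        moreover have "insert j B \<in> indep"
          by (rule indep_down_closed[OF B'(3)]) (use B'(1) j in blast)
        then have "card (insert j B) \<le> rank_fun indep (insert j (A \<inter> S))"
          using B by (intro card_le_rank_fun) auto
        ultimately show False using j B' unfolding C_def by auto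
      qed
    qed
    then show ?thesis using B B' by (metis order_refl subset_antisym)
  qed
  moreover have "C \<subseteq> N" using S unfolding C_def by blast
  then have "(\<Sum>i\<in>C. p i) \<le> real (rank_fun indep C)"
    using p unfolding matroid_polytope_def by simp
  ultimately have "(\<Sum>i\<in>C. p i) \<le> real r" by linarith
  moreover have "(\<Sum>i\<in>S - C. p i) \<le>
      (\<Sum>i\<in>N. p i * (real (rank_fun indep (insert i A \<inter> S)) - real r))"
  proof -
    have "(\<Sum>i\<in>S - C. p i) \<le>
        (\<Sum>i\<in>S - C. p i * (real (rank_fun indep (insert i A \<inter> S)) - real r))"
    proof (rule sum_mono)
      fix i assume i: "i \<in> S - C"
      then have "insert i A \<inter> S = insert i (A \<inter> S)" by auto
      then have "r < rank_fun indep (insert i A \<inter> S)"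
        using gain[of i] i unfolding C_def by auto
      then have "1 \<le> real (rank_fun indep (insert i A \<inter> S)) - real r" by linarith
      then show "p i \<le> p i * (real (rank_fun indep (insert i A \<inter> S)) - real r)"
        using p0[of i] i S by (auto simp: mult_le_cancel_left1)
    qed
    also have "\<dots> \<le> (\<Sum>i\<in>N. p i * (real (rank_fun indep (insert i A \<inter> S)) - real r))"
      using finite_ground S p0 gain by (intro sum_mono2) auto
    finally show ?thesis .
  qed
  moreover have "(\<Sum>i\<in>S. p i) = (\<Sum>i\<in>S - C. p i) + (\<Sum>i\<in>C. p i)"
    using finS by (intro sum.subset_diff) (auto simp: C_def)
  ultimately show ?thesis unfolding r_def by simp
qed

text \<open>Thresholds are treated in decreasing order, each time extending the current set to a
  maximum independent set of the larger level set. Higher levels keep full rank: their parts never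
  shrink and cannot exceed the rank.\<close>

lemma greedy_indep:
  fixes w :: "'a \<Rightarrow> real"
  assumes "finite V"
  obtains I where "I \<in> indep" "I \<subseteq> A"
    "\<And>t. t \<in> V \<Longrightarrow> card {i \<in> I. t \<le> w i} = rank_fun indep {i \<in> A. t \<le> w i}"
proof -
  \<comment> \<open>The strengthening that every chosen element reaches a threshold already treated
    puts \<open>I\<close> inside the next level set.\<close>
  have "\<exists>I\<in>indep. (\<forall>i\<in>I. i \<in> A \<and> (\<exists>t\<in>V. t \<le> w i)) \<and>
      (\<forall>t\<in>V. card {i \<in> I. t \<le> w i} = rank_fun indep {i \<in> A. t \<le> w i})"
    using assms
  proof (induction V rule: finite_linorder_min_induct)
    case empty
    then show ?case using empty_indep by (intro bexI[of _ "{}"]) auto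
  next
    case (insert u V)
    then obtain I where I: "I \<in> indep" "\<forall>i\<in>I. i \<in> A \<and> (\<exists>t\<in>V. t \<le> w i)"
      "\<forall>t\<in>V. card {i \<in> I. t \<le> w i} = rank_fun indep {i \<in> A. t \<le> w i}" by blast
    have "I \<subseteq> {i \<in> A. u \<le> w i}" using I(2) insert.hyps by force
    then obtain B where B: "I \<subseteq> B" "B \<subseteq> {i \<in> A. u \<le> w i}" "B \<in> indep"
      "card B = rank_fun indep {i \<in> A. u \<le> w i}"
      using extend_indep I(1) by blast
    have "card {i \<in> B. t \<le> w i} = rank_fun indep {i \<in> A. t \<le> w i}" if "t \<in> V" for t
    proof (rule antisym)
      show "card {i \<in> B. t \<le> w i} \<le> rank_fun indep {i \<in> A. t \<le> w i}"
        by (rule card_le_rank_fun[OF indep_down_closed[OF B(3)]]) (use B(2) in blast)+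
      have "card {i \<in> I. t \<le> w i} \<le> card {i \<in> B. t \<le> w i}"
        using B(1) indep_finite[OF B(3)] by (intro card_mono) auto
      then show "rank_fun indep {i \<in> A. t \<le> w i} \<le> card {i \<in> B. t \<le> w i}"
        using I(3) that by simp
    qed
    moreover have "{i \<in> B. u \<le> w i} = B" using B by auto
    ultimately show ?case using B by (intro bexI[of _ B]) auto
  qed
  then obtain I where "I \<in> indep" "\<forall>i\<in>I. i \<in> A"
    "\<forall>t\<in>V. card {i \<in> I. t \<le> w i} = rank_fun indep {i \<in> A. t \<le> w i}" by blast
  then show ?thesis by (intro that[of I]) auto
qed

section \<open>The contention resolution scheme\<close>

lemma rank_correlation_gap:
  assumes p: "p \<in> matroid_polytope N indep" and b: "0 \<le> b" "b \<le> 1" and S: "S \<subseteq> N"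
  shows "(1 - (1 - b / real (card N)) ^ card N) * (\<Sum>i\<in>S. p i)
    \<le> multilinear_ext (\<lambda>i\<in>N. b * p i) (\<lambda>A. real (rank_fun indep (A \<inter> S))) N"
proof (rule correlation_gap[OF finite_ground b, where p = p])
  have "p \<in> N \<rightarrow>\<^sub>E {0..1}" using p unfolding matroid_polytope_def by blast
  then show "0 \<le> p i \<and> p i \<le> 1" if "i \<in> N" for i using PiE_mem that by force
  show "real (rank_fun indep (A \<inter> S)) \<le> real (rank_fun indep (insert i A \<inter> S))" for A i
    by (intro of_nat_mono rank_fun_mono) blast
  show "real (rank_fun indep (insert i (insert j A) \<inter> S)) + real (rank_fun indep (A \<inter> S))
      \<le> real (rank_fun indep (insert i A \<inter> S)) + real (rank_fun indep (insert j A \<inter> S))" for A i j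
  proof -
    have "rank_fun indep (A \<inter> S) \<le> rank_fun indep ((insert i A \<inter> S) \<inter> (insert j A \<inter> S))"
      by (intro rank_fun_mono) blast
    moreover have "insert i (insert j A) \<inter> S = (insert i A \<inter> S) \<union> (insert j A \<inter> S)" by blast
    ultimately show ?thesis
      using rank_fun_submodular[of "insert i A \<inter> S" "insert j A \<inter> S"] by simp
  qed
qed (simp_all add: polytope_sum_le_marginals[OF p S])

text \<open>The best response to weights \<open>w\<close>: on each upper level set the greedy choice
  attains the rank, so \<open>gap\<close> applies there, and \<open>sum_weighted_nonneg\<close>
  combines the levels.\<close>

lemma greedy_selection:
  fixes x w :: "'a \<Rightarrow> real" and M :: "'a set" and c :: real
  assumes MN: "M \<subseteq> N"
    and gap: "\<And>S. S \<subseteq> M \<Longrightarrow>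
      c * (\<Sum>i\<in>S. x i) \<le> multilinear_ext x (\<lambda>A. real (rank_fun indep (A \<inter> S))) N"
    and w: "\<And>i. i \<in> M \<Longrightarrow> 0 \<le> w i"
  obtains s where "s \<in> (\<Pi>\<^sub>E A\<in>Pow N. {I \<in> indep. I \<subseteq> A \<inter> M})"
    "(\<Sum>i\<in>M. w i * (c * x i)) \<le> (\<Sum>i\<in>M. w i * multilinear_ext x (\<lambda>A. of_bool (i \<in> s A)) N)"
proof -
  have finM: "finite M" using MN finite_ground by (rule finite_subset)
  have "\<exists>I. I \<in> indep \<and> I \<subseteq> A \<inter> M \<and>
      (\<forall>t\<in>w ` M. card {i \<in> I. t \<le> w i} = rank_fun indep {i \<in> A \<inter> M. t \<le> w i})" for A
    by (rule greedy_indep[OF finite_imageI[OF finM, of w], of "A \<inter> M" w]) (intro exI conjI ballI)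
  then obtain g where g: "\<And>A. g A \<in> indep" "\<And>A. g A \<subseteq> A \<inter> M"
    "\<And>A t. t \<in> w ` M \<Longrightarrow> card {i \<in> g A. t \<le> w i} = rank_fun indep {i \<in> A \<inter> M. t \<le> w i}"
    by metis
  define s where "s = restrict g (Pow N)"
  define d where "d i = multilinear_ext x (\<lambda>A. of_bool (i \<in> s A)) N - c * x i" for i
  have "0 \<le> (\<Sum>i\<in>M. w i * d i)"
  proof (rule sum_weighted_nonneg[OF finM w])
    fix t assume t: "t \<in> w ` M"
    let ?S = "{i. i \<in> M \<and> t \<le> w i}"
    have "c * (\<Sum>i\<in>?S. x i) \<le> multilinear_ext x (\<lambda>A. real (rank_fun indep (A \<inter> ?S))) N"
      by (rule gap) blast
    also have "\<dots> \<le> multilinear_ext x (\<lambda>A. \<Sum>i\<in>?S. of_bool (i \<in> s A)) N"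
    proof (intro multilinear_ext_mono finite_ground)
      fix A assume "A \<subseteq> N"
      then have "{i \<in> g A. t \<le> w i} = {i \<in> ?S. i \<in> s A}"
        using g(2)[of A] unfolding s_def by auto
      moreover have "{i \<in> A \<inter> M. t \<le> w i} = A \<inter> ?S" by blast
      ultimately have "rank_fun indep (A \<inter> ?S) = card {i \<in> ?S. i \<in> s A}"
        using g(3)[OF t, of A] by simp
      also have "real \<dots> = (\<Sum>i\<in>?S. of_bool (i \<in> s A))"
        using finM by (simp add: of_bool_def sum.If_cases Int_def)
      finally show "real (rank_fun indep (A \<inter> ?S)) \<le> (\<Sum>i\<in>?S. of_bool (i \<in> s A))" by simp
    qed
    also have "\<dots> = (\<Sum>i\<in>?S. multilinear_ext x (\<lambda>A. of_bool (i \<in> s A)) N)"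
      by (rule multilinear_ext_sum[OF finite_ground])
    finally show "0 \<le> (\<Sum>i\<in>?S. d i)"
      unfolding d_def sum_subtractf by (simp add: sum_distrib_left)
  qed
  then have "(\<Sum>i\<in>M. w i * (c * x i)) \<le> (\<Sum>i\<in>M. w i * multilinear_ext x (\<lambda>A. of_bool (i \<in> s A)) N)"
    unfolding d_def right_diff_distrib sum_subtractf by simp
  moreover have "s \<in> (\<Pi>\<^sub>E A\<in>Pow N. {I \<in> indep. I \<subseteq> A \<inter> M})"
    unfolding s_def using g(1,2) by (intro restrict_PiE_iff[THEN iffD2]) blast
  ultimately show ?thesis using that by blast
qed

lemma balanced_selection_mixture:
  fixes x :: "'a \<Rightarrow> real" and c :: real
  assumes MN: "M \<subseteq> N"
    and gap: "\<And>S. S \<subseteq> M \<Longrightarrow>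
      c * (\<Sum>i\<in>S. x i) \<le> multilinear_ext x (\<lambda>A. real (rank_fun indep (A \<inter> S))) N"
  obtains q where "set_pmf q \<subseteq> (\<Pi>\<^sub>E A\<in>Pow N. {I \<in> indep. I \<subseteq> A \<inter> M})"
    "\<And>i. i \<in> M \<Longrightarrow>
      c * x i \<le> measure_pmf.expectation q (\<lambda>s. multilinear_ext x (\<lambda>A. of_bool (i \<in> s A)) N)"
proof -
  let ?Sel = "\<Pi>\<^sub>E A\<in>Pow N. {I \<in> indep. I \<subseteq> A \<inter> M}"
  have "finite indep" using indep_subset finite_ground finite_subset by blast
  \<comment> \<open>Selections are extensional on \<open>Pow N\<close>, which leaves finitely many
    pure strategies for the minimax theorem.\<close>
  then have "finite ?Sel" by (intro finite_PiE) (auto simp: finite_ground)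
  moreover have "finite M" using MN finite_ground by (rule finite_subset)
  moreover have "\<exists>s\<in>?Sel. (\<Sum>i\<in>M. w i * (c * x i)) \<le>
      (\<Sum>i\<in>M. w i * multilinear_ext x (\<lambda>A. of_bool (i \<in> s A)) N)"
    if "\<And>i. i \<in> M \<Longrightarrow> 0 \<le> w i" for w
    by (rule greedy_selection[where w = w, OF MN gap that]) (assumption | rule bexI)+
  ultimately show ?thesis
    using that
    by (rule finite_minimax[where M = "\<lambda>s i. multilinear_ext x (\<lambda>A. of_bool (i \<in> s A)) N"
          and t = "\<lambda>i. c * x i"])
qed

text \<open>Drawing \<open>s\<close> after seeing \<open>A\<close> has the same joint law as drawing
  it beforehand, since \<open>q\<close> does not depend on \<open>A\<close>. So the joint
  probability is an average over fixed selections, and \<open>i \<in> A\<close> has probability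
  \<open>x i\<close>.\<close>

lemma mixture_cond_prob_ge:
  fixes x :: "'a \<Rightarrow> real" and c :: real
  assumes sel: "set_pmf q \<subseteq> (\<Pi>\<^sub>E A\<in>Pow N. {I \<in> indep. I \<subseteq> A \<inter> M})"
    and q: "c * x i \<le> measure_pmf.expectation q (\<lambda>s. multilinear_ext x (\<lambda>A. of_bool (i \<in> s A)) N)"
    and \<pi>: "\<And>A. \<pi> x A = map_pmf (\<lambda>s. s A) q"
    and i: "i \<in> N" "0 < x i" "x i \<le> 1"
  shows "c \<le> \<P>((A, B) in sample_and_select N \<pi> x. i \<in> B \<bar> i \<in> A)"
proof -
  let ?J = "sample_and_select N \<pi> x" and ?R = "random_set N x"
  let ?Sel = "\<Pi>\<^sub>E A\<in>Pow N. {I \<in> indep. I \<subseteq> A \<inter> M}"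
  let ?E = "{\<omega>. case \<omega> of (A, B) \<Rightarrow> i \<in> B \<and> i \<in> A}"
  have "finite indep" using indep_subset finite_ground finite_subset by blast
  then have finSel: "finite ?Sel" by (intro finite_PiE) (auto simp: finite_ground)
  then have finq: "finite (set_pmf q)" using sel finite_subset by blast
  have "?J = bind_pmf ?R (\<lambda>A. bind_pmf q (\<lambda>s. return_pmf (A, s A)))"
    unfolding sample_and_select_def \<pi> by (simp add: map_pmf_comp map_pmf_def[symmetric] comp_def)
  also have "\<dots> = bind_pmf q (\<lambda>s. map_pmf (\<lambda>A. (A, s A)) ?R)"
    unfolding map_pmf_def by (rule bind_commute_pmf)
  finally have J: "?J = bind_pmf q (\<lambda>s. map_pmf (\<lambda>A. (A, s A)) ?R)" .
  have "measure_pmf.prob ?J ?E = measure_pmf.expectation ?J (indicator ?E)"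
    by simp
  also have "\<dots> = (\<Sum>s\<in>set_pmf q. pmf q s *\<^sub>R multilinear_ext x (\<lambda>A. indicator ?E (A, s A)) N)"
    unfolding J by (subst pmf_expectation_bind[OF finq])
      (simp_all only: multilinear_ext_def set_map_pmf finite_imageI finite_set_pmf_random_set
        finite_ground integral_map_pmf order_refl)
  also have "\<dots> \<ge> (\<Sum>s\<in>set_pmf q. pmf q s *\<^sub>R multilinear_ext x (\<lambda>A. of_bool (i \<in> s A)) N)"
  proof (intro sum_mono scaleR_left_mono multilinear_ext_mono finite_ground pmf_nonneg)
    fix s A assume "s \<in> set_pmf q" "A \<subseteq> N"
    then have "s A \<subseteq> A" using sel by (auto dest: PiE_mem[of s _ _ A])
    then show "of_bool (i \<in> s A) \<le> (indicator ?E (A, s A) :: real)"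
      by (auto simp: indicator_def)
  qed
  also have "(\<Sum>s\<in>set_pmf q. pmf q s *\<^sub>R multilinear_ext x (\<lambda>A. of_bool (i \<in> s A)) N) =
      measure_pmf.expectation q (\<lambda>s. multilinear_ext x (\<lambda>A. of_bool (i \<in> s A)) N)"
    by (rule integral_measure_pmf[OF finq, symmetric])
  finally have num: "c * x i \<le> measure_pmf.prob ?J ?E" using q by linarith
  have "map_pmf fst ?J = ?R"
    unfolding J by (simp add: map_bind_pmf map_pmf_comp)
  then have "measure_pmf.prob ?R {A. i \<in> A} = measure_pmf.prob ?J (fst -` {A. i \<in> A})"
    by (metis measure_map_pmf)
  moreover have "fst -` {A. i \<in> A} = {\<omega>. case \<omega> of (A, B) \<Rightarrow> i \<in> A}" by auto
  ultimately have den: "measure_pmf.prob ?J {\<omega>. case \<omega> of (A, B) \<Rightarrow> i \<in> A} = x i"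
    using prob_mem_random_set[where x = x, OF finite_ground i(1) less_imp_le[OF i(2)] i(3)] by metis
  show ?thesis
    using num den i(2) by (simp add: cond_prob_def case_prod_unfold pos_le_divide_eq)
qed

end

theorem theorem4p8:
  fixes N :: "'a set" and indep :: "'a set set" and n :: nat and b :: real
  assumes "matroid N indep" and "card N = n" and "b \<in> {0..1}"
  shows "\<exists>\<pi>. balanced_CR_scheme N indep b ((1 - (1 - b / real n) ^ n) / b) \<pi>"
proof -
  interpret matroid N indep by fact
  define c where "c = (1 - (1 - b / real n) ^ n) / b"
  define M where "M x = {i \<in> N. 0 < x i}" for x :: "'a \<Rightarrow> real"
  let ?X = "scaled N b (matroid_polytope N indep)"
  let ?Sel = "\<lambda>x. \<Pi>\<^sub>E A\<in>Pow N. {I \<in> indep. I \<subseteq> A \<inter> M x}"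
  have b: "0 \<le> b" "b \<le> 1" using assms(3) by auto
  \<comment> \<open>For \<open>b = 0\<close> division by zero gives \<open>c = 0\<close>, and the
    right-hand side is 0 as well.\<close>
  have cb: "c * b = 1 - (1 - b / real n) ^ n" unfolding c_def by simp
  have "\<forall>x\<in>?X. \<exists>q. set_pmf q \<subseteq> ?Sel x \<and> (\<forall>i\<in>M x. c * x i \<le>
      measure_pmf.expectation q (\<lambda>s. multilinear_ext x (\<lambda>A. of_bool (i \<in> s A)) N))"
  proof
    fix x assume x: "x \<in> ?X"
    obtain p where p: "p \<in> matroid_polytope N indep" "x = (\<lambda>i\<in>N. b * p i)"
      using x unfolding scaled_def by blast
    have MN: "M x \<subseteq> N" unfolding M_def by blast
    have gap: "c * (\<Sum>i\<in>S. x i) \<le> multilinear_ext x (\<lambda>A. real (rank_fun indep (A \<inter> S))) N"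
      if "S \<subseteq> M x" for S
    proof -
      have S: "S \<subseteq> N" using that MN by blast
      then have "(\<Sum>i\<in>S. x i) = b * (\<Sum>i\<in>S. p i)"
        unfolding p(2) sum_distrib_left by (intro sum.cong) auto
      then have "c * (\<Sum>i\<in>S. x i) = (1 - (1 - b / real n) ^ n) * (\<Sum>i\<in>S. p i)"
        by (simp only: cb[symmetric] mult.assoc)
      then show ?thesis
        using rank_correlation_gap[OF p(1) b S] unfolding assms(2) p(2) by simp
    qed
    show "\<exists>q. set_pmf q \<subseteq> ?Sel x \<and> (\<forall>i\<in>M x. c * x i \<le>
        measure_pmf.expectation q (\<lambda>s. multilinear_ext x (\<lambda>A. of_bool (i \<in> s A)) N))"
      by (rule balanced_selection_mixture[OF MN gap]) (assumption | intro exI conjI ballI)+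
  qed
  from bchoice[OF this] obtain q where
    "\<forall>x\<in>?X. set_pmf (q x) \<subseteq> ?Sel x \<and> (\<forall>i\<in>M x. c * x i \<le>
      measure_pmf.expectation (q x) (\<lambda>s. multilinear_ext x (\<lambda>A. of_bool (i \<in> s A)) N))"
    by (rule exE)
  then have q: "x \<in> ?X \<Longrightarrow> set_pmf (q x) \<subseteq> ?Sel x"
    "x \<in> ?X \<Longrightarrow> i \<in> M x \<Longrightarrow> c * x i \<le>
      measure_pmf.expectation (q x) (\<lambda>s. multilinear_ext x (\<lambda>A. of_bool (i \<in> s A)) N)" for x i
    by (simp_all only: Ball_def)
  define \<pi> where "\<pi> x A = map_pmf (\<lambda>s. s A) (q x)" for x A
  have "balanced_CR_scheme N indep b c \<pi>"
    unfolding balanced_CR_scheme_def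
  proof (intro ballI conjI allI impI)
    fix x assume x: "x \<in> ?X"
    {
      fix A assume A: "A \<subseteq> N"
      have *: "set_pmf (\<pi> x A) \<subseteq> {I \<in> indep. I \<subseteq> A \<inter> M x}"
        unfolding \<pi>_def using q(1)[OF x] A by (auto dest: PiE_mem[of _ _ _ A])
      then show "set_pmf (\<pi> x A) \<subseteq> Pow (A \<inter> {i \<in> N. x i > 0})"
        unfolding M_def by blast
      show "measure_pmf.prob (\<pi> x A) indep = 1"
        using * by (subst measure_pmf.prob_eq_1) (auto simp: AE_measure_pmf_iff)
    }
    fix i assume i: "i \<in> N" "x i > 0"
    obtain p where p: "p \<in> matroid_polytope N indep" "x = (\<lambda>i\<in>N. b * p i)"
      using x unfolding scaled_def by blast
    have "p \<in> N \<rightarrow>\<^sub>E {0..1}" using p(1) unfolding matroid_polytope_def by blast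
    then have "p i \<in> {0..1}" using i(1) by (rule PiE_mem)
    then have "x i \<le> 1" using b i(1) p(2) by (auto intro: mult_le_one)
    then show "c \<le> \<P>((A, B) in sample_and_select N \<pi> x. i \<in> B \<bar> i \<in> A)"
      using i by (intro mixture_cond_prob_ge[OF q(1)[OF x] q(2)[OF x]]) (auto simp: M_def \<pi>_def)
  qed
  then show ?thesis unfolding c_def by blast
qed

end
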